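(* Let $g:[0,1]^2\to\mathbb{R}^p$ be integrable. Suppose that the map $\varphi(\theta)=\iint_{[0,1]^2} g(x,y)\,l(x,y;\theta)\,\mathrm{d}x\,\mathrm{d}y$ is a homeomorphism between $\Theta^o$ (the interior of $\Theta$) and $\varphi(\Theta^o)$, and that the true parameter $\theta_0$ lies in $\Theta^o$. Then, as $n\to\infty$, $k=k_n\to\infty$ and $k/n\to 0$, the quantity $\varphi^{-1}\left(\iint_{[0,1]^2} g(x,y)\hat{l}_n(x,y)\,\mathrm{d}x\,\mathrm{d}y\right)$ is well defined with probability tending to $1$ (i.e. $\mathbb{P}\left(\iint_{[0,1]^2} g\,\hat{l}_n\in\varphi(\Theta^o)\right)\to 1$), and the moment estimator $\hat\theta_n$ satisfies $\hat\theta_n\to\theta_0$ in probability.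
   Context: Let $(X,Y),(X_1,Y_1),(X_2,Y_2),\ldots$ be independent random vectors in $\mathbb{R}^2$ with common continuous distribution function $F$ and marginal distribution functions $F_1,F_2$. Assume that $F$ has a stable tail dependence function $l$, i.e. for all $x,y\ge 0$ the limit $$l(x,y)=\lim_{t\downarrow 0}t^{-1}\mathbb{P}\{1-F_1(X)\le tx\text{ or }1-F_2(Y)\le ty\}$$ exists. Assume that $l$ belongs to a parametric family of stable tail dependence functions $\{l(\cdot,\cdot;\theta):\theta\in\Theta\}$, $\Theta\subset\mathbb{R}^p$, $p\ge 1$, and $l=l(\cdot,\cdot;\theta_0)$, where $\theta_0$ is the true parameter. (No further parametric assumption is made on $F$.) Nonparametric estimator: let $R_i^X$ be the rank of $X_i$ among $X_1,\ldots,X_n$ and $R_i^Y$ the rank of $Y_i$ among $Y_1,\ldots,Y_n$. For $k=k_n\in\{1,\ldots,n\}$ put $$\hat l_n(x,y)=\frac1k\sum_{i=1}^n\mathbf{1}\left\{R_i^X>n+\tfrac12-kx\ \text{ or }\ R_i^Y>n+\tfrac12-ky\right\}.$$ Moment estimator: $\hat\theta_n=\varphi^{-1}\left(\iint_{[0,1]^2}g(x,y)\hat l_n(x,y)\,\mathrm{d}x\,\mathrm{d}y\right)$ if $\iint_{[0,1]^2} g\,\hat l_n\in\varphi(\Theta^o)$, where $\varphi^{-1}$ is the inverse of $\varphi:\Theta^o\to\varphi(\Theta^o)$; otherwise $\hat\theta_n$ is some arbitrary fixed value in $\Theta$. *)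

theory Defs
  imports "HOL-Probability.Probability"
begin

definition joint_cdf :: "'a measure \<Rightarrow> ('a \<Rightarrow> real) \<Rightarrow> ('a \<Rightarrow> real) \<Rightarrow> real \<times> real \<Rightarrow> real" where
  "joint_cdf M X Y = (\<lambda>(x, y). measure M {\<omega> \<in> space M. X \<omega> \<le> x \<and> Y \<omega> \<le> y})"

text \<open>The values of \<open>l\<close> matter only for nonnegative arguments.\<close>

definition has_stdf ::
  "'a measure \<Rightarrow> ('a \<Rightarrow> real) \<Rightarrow> ('a \<Rightarrow> real) \<Rightarrow> (real \<Rightarrow> real \<Rightarrow> real) \<Rightarrow> bool" where
  "has_stdf M X Y l \<longleftrightarrow>
    (\<forall>x\<ge>0. \<forall>y\<ge>0.
      ((\<lambda>t. inverse t * measure M {\<omega> \<in> space M.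
          1 - cdf (distr M borel X) (X \<omega>) \<le> t * x \<or> 1 - cdf (distr M borel Y) (Y \<omega>) \<le> t * y})
        \<longlongrightarrow> l x y) (at_right 0))"

text \<open>A stable tail dependence function is one that arises from some law on the plane with
  continuous distribution function.\<close>

definition is_stdf :: "(real \<Rightarrow> real \<Rightarrow> real) \<Rightarrow> bool" where
  "is_stdf l \<longleftrightarrow>
    (\<exists>\<mu> :: (real \<times> real) measure. prob_space \<mu> \<and> sets \<mu> = sets borel \<and>
      continuous_on UNIV (joint_cdf \<mu> fst snd) \<and> has_stdf \<mu> fst snd l)"

text \<open>Samples are indexed by \<open>1, \<dots>, n\<close>. Ties get the maximal rank; under a
  continuous distribution function they have probability zero.\<close>

definition sample_rank :: "nat \<Rightarrow> (nat \<Rightarrow> real) \<Rightarrow> nat \<Rightarrow> nat" where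
  "sample_rank n u i = card {j \<in> {1..n}. u j \<le> u i}"

definition emp_stdf ::
  "nat \<Rightarrow> nat \<Rightarrow> (nat \<Rightarrow> real) \<Rightarrow> (nat \<Rightarrow> real) \<Rightarrow> real \<Rightarrow> real \<Rightarrow> real" where
  "emp_stdf n k u v x y =
    (1 / real k) * (\<Sum>i = 1..n. of_bool
      (real (sample_rank n u i) > real n + 1/2 - real k * x \<or>
       real (sample_rank n v i) > real n + 1/2 - real k * y))"

abbreviation unit_square :: "(real \<times> real) set" where
  "unit_square \<equiv> {0..1} \<times> {0..1}"

definition moment ::
  "(real \<times> real \<Rightarrow> real ^ 'p) \<Rightarrow> (real \<Rightarrow> real \<Rightarrow> real) \<Rightarrow> real ^ 'p" where
  "moment g f = set_lebesgue_integral lebesgue unit_square (\<lambda>(x, y). f x y *\<^sub>R g (x, y))"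

text \<open>\<open>\<theta>'\<close> is the fallback value used where the inverse is undefined.\<close>

definition moment_estimator ::
  "(real \<times> real \<Rightarrow> real ^ 'p) \<Rightarrow> (real ^ 'p \<Rightarrow> real \<Rightarrow> real \<Rightarrow> real) \<Rightarrow> (real ^ 'p) set \<Rightarrow> real ^ 'p
    \<Rightarrow> nat \<Rightarrow> nat \<Rightarrow> (nat \<Rightarrow> real) \<Rightarrow> (nat \<Rightarrow> real) \<Rightarrow> real ^ 'p" where
  "moment_estimator g l Theta \<theta>' n k u v =
    (let \<phi> = (\<lambda>\<theta>. moment g (l \<theta>)); m = moment g (emp_stdf n k u v)
     in if m \<in> \<phi> ` interior Theta then the_inv_into (interior Theta) \<phi> m else \<theta>')"

definition tendsto_in_probability ::
  "'a measure \<Rightarrow> (nat \<Rightarrow> 'a \<Rightarrow> 'b :: metric_space) \<Rightarrow> 'b \<Rightarrow> bool" where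
  "tendsto_in_probability M Z c \<longleftrightarrow>
    (\<forall>n. Z n \<in> borel_measurable M) \<and>
    (\<forall>\<epsilon>>0. (\<lambda>n. measure M {\<omega> \<in> space M. dist (Z n \<omega>) c > \<epsilon>}) \<longlonglongrightarrow> 0)"

end

theory Submission
  imports Defs
begin

text \<open>
  The moment estimator is a continuous function, near \<open>\<phi> \<theta>0\<close>, of the moment of the empirical
  tail dependence function. By invariance of domain the image of the interior of the parameter set
  is open, so it contains a neighbourhood of \<open>\<phi> \<theta>0\<close>, and the inverse of \<open>\<phi>\<close> is continuous there
  (\<open>homeomorphism_interior_inverse_continuous\<close>). Both claims follow once the empirical moment
  converges to \<open>\<phi> \<theta>0\<close> in probability, and since \<open>g\<close> is integrable it suffices that the empirical
  tail dependence function converges to \<open>l\<close> uniformly on the unit square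
  (\<open>emp_uniform_whp\<close>, \<open>norm_moment_diff_le\<close>).

  For fixed \<open>x\<close> and \<open>y\<close> the difficulty is that ranks are dependent. Write \<open>S\<close> and \<open>T\<close> for the
  marginal survival functions. An observation with rank above \<open>n + 1/2 - k x\<close> is one of the
  roughly \<open>k x\<close> largest, hence roughly one with \<open>S (X i) \<le> k x / n\<close>. More precisely, if more than
  \<open>k x\<close> observations satisfy \<open>S (X i) \<le> k (x + \<delta>) / n\<close>, then all observations of high rank do,
  and if fewer than \<open>k x\<close> satisfy \<open>S (X i) \<le> k (x - \<delta>) / n\<close>, then all of these have high rank.
  So the empirical function is squeezed between two counts of independent events
  (\<open>scaled_count_le_emp_stdf\<close>, \<open>emp_stdf_le_scaled_count\<close>), whose means converge by the
  definition of \<open>l\<close> and whose variances vanish (\<open>scaled_count_tendsto_in_probability\<close>). The same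
  law of large numbers applied to the margins, where \<open>S (X i)\<close> is uniform, shows that the
  conditions of the squeeze hold with probability tending to one. Uniformity of the margins also
  makes \<open>l\<close> Lipschitz continuous (\<open>L_lipschitz\<close>), so that \<open>\<delta>\<close> can be sent to zero, and
  monotonicity upgrades pointwise to uniform convergence.
\<close>

section \<open>Ranks and thresholds\<close>

definition scaled_count :: "nat \<Rightarrow> nat \<Rightarrow> (nat \<Rightarrow> bool) \<Rightarrow> real" where
  "scaled_count n k P = (1 / real k) * (\<Sum>i = 1..n. of_bool (P i))"

lemma scaled_count_mono:
  "(\<And>i. i \<in> {1..n} \<Longrightarrow> P i \<Longrightarrow> Q i) \<Longrightarrow> scaled_count n k P \<le> scaled_count n k Q"
  unfolding scaled_count_def by (intro mult_left_mono sum_mono) auto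

lemma scaled_count_card: "scaled_count n k P = real (card {i \<in> {1..n}. P i}) / real k"
  unfolding scaled_count_def by (simp add: of_bool_def sum.If_cases Int_def)

text \<open>Here \<open>S\<close> plays the role of the survival function of the margin of \<open>u\<close>. Every point below the
  level \<open>s\<close> of \<open>S\<close> is strictly larger than every point above that level, so a point above the level
  has at least as many points ahead of it as lie below the level; if these are about \<open>k x\<close> many,
  its rank is too small.\<close>

lemma rank_high_imp_below_threshold:
  fixes S :: "real \<Rightarrow> real"
  assumes "antimono S" "k > 0" "x - 1 / (2 * real k) \<le> scaled_count n k (\<lambda>j. S (u j) \<le> s)"
    and "i \<in> {1..n}" "real (sample_rank n u i) > real n + 1/2 - real k * x"
  shows "S (u i) \<le> s"
proof (rule ccontr)
  assume "\<not> S (u i) \<le> s"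
  let ?B = "{j \<in> {1..n}. S (u j) \<le> s}" and ?R = "{j \<in> {1..n}. u j \<le> u i}"
  have "?B \<inter> ?R = {}"
    using \<open>antimono S\<close> \<open>\<not> S (u i) \<le> s\<close> by (fastforce dest: antimonoD)
  then have "card ?B + card ?R = card (?B \<union> ?R)"
    by (simp add: card_Un_disjoint)
  also have "\<dots> \<le> card {1..n}"
    by (intro card_mono) auto
  finally have "card ?B + sample_rank n u i \<le> n"
    by (simp add: sample_rank_def)
  then have "real (card ?B) + real (sample_rank n u i) \<le> real n"
    by linarith
  moreover have "real k * x - 1/2 \<le> real (card ?B)"
    using mult_left_mono[OF assms(3), of "real k"] assms(2)
    by (simp add: scaled_count_card algebra_simps)
  ultimately show False
    using assms(5) by linarith
qed

text \<open>Conversely, whatever is strictly larger than a point below the level \<open>s\<close> is itself below that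
  level. Counting the point itself gives the extra one that turns the bound \<open>k x + 1/2\<close> on the
  number of points below the level into the rank condition.\<close>

lemma below_threshold_imp_rank_high:
  fixes S :: "real \<Rightarrow> real"
  assumes "antimono S" "k > 0" "scaled_count n k (\<lambda>j. S (u j) \<le> s) < x + 1 / (2 * real k)"
    and "i \<in> {1..n}" "S (u i) \<le> s"
  shows "real (sample_rank n u i) > real n + 1/2 - real k * x"
proof -
  let ?B = "{j \<in> {1..n}. S (u j) \<le> s}" and ?R = "{j \<in> {1..n}. u j \<le> u i}"
  have "{1..n} \<subseteq> (?B - {i}) \<union> ?R"
  proof
    fix j assume "j \<in> {1..n}"
    then show "j \<in> (?B - {i}) \<union> ?R"
      using antimonoD[OF \<open>antimono S\<close>, of "u i" "u j"] \<open>S (u i) \<le> s\<close>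
      by (cases "u j \<le> u i") auto
  qed
  then have "card {1..n} \<le> card (?B - {i}) + card ?R"
    by (intro order.trans[OF card_mono card_Un_le]) auto
  moreover have "card ?B = Suc (card (?B - {i}))"
    using assms(4,5) by (intro card.remove) auto
  ultimately have "n + 1 \<le> card ?B + sample_rank n u i"
    by (simp add: sample_rank_def)
  then have "real n + 1 \<le> real (card ?B) + real (sample_rank n u i)"
    by linarith
  moreover have "real (card ?B) < real k * x + 1/2"
    using mult_strict_left_mono[OF assms(3), of "real k"] assms(2)
    by (simp add: scaled_count_card algebra_simps)
  ultimately show ?thesis
    by linarith
qed

text \<open>The empirical tail dependence function thus lies between two counts with deterministic
  thresholds as soon as the marginal counts at these thresholds lie on the right sides of
  \<open>k x\<close> and \<open>k y\<close>.\<close>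

lemma emp_stdf_le_scaled_count:
  fixes S T :: "real \<Rightarrow> real"
  assumes "antimono S" "antimono T" "k > 0"
    and "x - 1 / (2 * real k) \<le> scaled_count n k (\<lambda>j. S (u j) \<le> s)"
    and "y - 1 / (2 * real k) \<le> scaled_count n k (\<lambda>j. T (v j) \<le> t)"
  shows "emp_stdf n k u v x y \<le> scaled_count n k (\<lambda>i. S (u i) \<le> s \<or> T (v i) \<le> t)"
  unfolding emp_stdf_def scaled_count_def[symmetric]
  using rank_high_imp_below_threshold[of S k x n u s] rank_high_imp_below_threshold[of T k y n v t] assms
  by (intro scaled_count_mono) blast

lemma scaled_count_le_emp_stdf:
  fixes S T :: "real \<Rightarrow> real"
  assumes "antimono S" "antimono T" "k > 0"
    and "scaled_count n k (\<lambda>j. S (u j) \<le> s) < x + 1 / (2 * real k)"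
    and "scaled_count n k (\<lambda>j. T (v j) \<le> t) < y + 1 / (2 * real k)"
  shows "scaled_count n k (\<lambda>i. S (u i) \<le> s \<or> T (v i) \<le> t) \<le> emp_stdf n k u v x y"
  unfolding emp_stdf_def scaled_count_def[symmetric]
  using below_threshold_imp_rank_high[of S k n u s x] below_threshold_imp_rank_high[of T k n v t y] assms
  by (intro scaled_count_mono) blast

lemma emp_stdf_mono:
  assumes "x \<le> x'" "y \<le> y'"
  shows "emp_stdf n k u v x y \<le> emp_stdf n k u v x' y'"
proof -
  have "real k * x \<le> real k * x'" "real k * y \<le> real k * y'"
    using assms by (auto intro: mult_left_mono)
  then show ?thesis
    unfolding emp_stdf_def scaled_count_def[symmetric] by (intro scaled_count_mono) auto
qed

section \<open>Events of probability tending to one\<close>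

text \<open>Measurability is part of the notion, so that finite conjunctions need only a union bound.\<close>

definition whp :: "'a measure \<Rightarrow> (nat \<Rightarrow> 'a \<Rightarrow> bool) \<Rightarrow> bool" where
  "whp M E \<longleftrightarrow> (\<forall>n. {\<omega> \<in> space M. E n \<omega>} \<in> sets M) \<and>
    (\<lambda>n. measure M {\<omega> \<in> space M. \<not> E n \<omega>}) \<longlonglongrightarrow> 0"

lemma whp_sets: "whp M E \<Longrightarrow> {\<omega> \<in> space M. E n \<omega>} \<in> sets M"
  by (simp add: whp_def)

context prob_space
begin

lemma whp_mono:
  assumes "whp M E" "\<And>n. {\<omega> \<in> space M. G n \<omega>} \<in> events"
    and "\<forall>\<^sub>F n in sequentially. \<forall>\<omega>\<in>space M. E n \<omega> \<longrightarrow> G n \<omega>"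
  shows "whp M G"
proof -
  have sets: "{\<omega> \<in> space M. \<not> E n \<omega>} \<in> events" for n
    using whp_sets[OF assms(1)] by measurable
  have bound: "\<forall>\<^sub>F n in sequentially. prob {\<omega> \<in> space M. \<not> G n \<omega>} \<le> prob {\<omega> \<in> space M. \<not> E n \<omega>}"
    using assms(3)
  proof eventually_elim
    case (elim n)
    then show ?case
      by (intro finite_measure_mono sets) blast
  qed
  have lim: "(\<lambda>n. prob {\<omega> \<in> space M. \<not> E n \<omega>}) \<longlonglongrightarrow> 0"
    using assms(1) unfolding whp_def by blast
  have "(\<lambda>n. prob {\<omega> \<in> space M. \<not> G n \<omega>}) \<longlonglongrightarrow> 0"
    by (rule tendsto_sandwich[OF _ bound tendsto_const lim]) (rule always_eventually, rule allI, rule measure_nonneg)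
  then show ?thesis
    unfolding whp_def using assms(2) by blast
qed

lemma whp_conj:
  assumes "whp M E" "whp M G"
  shows "whp M (\<lambda>n \<omega>. E n \<omega> \<and> G n \<omega>)"
proof -
  have sets: "{\<omega> \<in> space M. E n \<omega>} \<in> events" "{\<omega> \<in> space M. G n \<omega>} \<in> events" for n
    using assms by (auto intro: whp_sets)
  have meas: "{\<omega> \<in> space M. \<not> E n \<omega>} \<in> events" "{\<omega> \<in> space M. \<not> G n \<omega>} \<in> events"
    "{\<omega> \<in> space M. E n \<omega> \<and> G n \<omega>} \<in> events" for n
    using sets by measurable
  have bound: "prob {\<omega> \<in> space M. \<not> (E n \<omega> \<and> G n \<omega>)}
    \<le> prob {\<omega> \<in> space M. \<not> E n \<omega>} + prob {\<omega> \<in> space M. \<not> G n \<omega>}" for n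
  proof -
    have "{\<omega> \<in> space M. \<not> (E n \<omega> \<and> G n \<omega>)}
      = {\<omega> \<in> space M. \<not> E n \<omega>} \<union> {\<omega> \<in> space M. \<not> G n \<omega>}" by auto
    then show ?thesis
      using measure_Un_le[OF meas(1,2)] by simp
  qed
  have lim: "(\<lambda>n. prob {\<omega> \<in> space M. \<not> E n \<omega>} + prob {\<omega> \<in> space M. \<not> G n \<omega>}) \<longlonglongrightarrow> 0"
    using assms unfolding whp_def by (intro tendsto_add_zero) auto
  have "(\<lambda>n. prob {\<omega> \<in> space M. \<not> (E n \<omega> \<and> G n \<omega>)}) \<longlonglongrightarrow> 0"
    using bound by (intro tendsto_sandwich[OF _ _ tendsto_const lim] always_eventually allI) (rule measure_nonneg)
  then show ?thesis
    unfolding whp_def using meas(3) by blast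
qed

lemma whp_finite_Ball:
  assumes "finite I" "\<And>i. i \<in> I \<Longrightarrow> whp M (E i)"
  shows "whp M (\<lambda>n \<omega>. \<forall>i\<in>I. E i n \<omega>)"
  using assms
proof (induction I rule: finite_induct)
  case empty
  then show ?case by (simp add: whp_def)
next
  case (insert i I)
  then have "whp M (\<lambda>n \<omega>. E i n \<omega> \<and> (\<forall>i\<in>I. E i n \<omega>))"
    by (intro whp_conj) auto
  then show ?case by simp
qed

lemma tendsto_in_probability_iff_whp:
  fixes Z :: "nat \<Rightarrow> 'a \<Rightarrow> 'b :: {metric_space, second_countable_topology}"
  assumes "\<And>n. Z n \<in> borel_measurable M"
  shows "tendsto_in_probability M Z c \<longleftrightarrow> (\<forall>\<epsilon>>0. whp M (\<lambda>n \<omega>. dist (Z n \<omega>) c \<le> \<epsilon>))"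
proof -
  have "{\<omega> \<in> space M. dist (Z n \<omega>) c \<le> \<epsilon>} \<in> events" for n \<epsilon>
    using assms[of n] by measurable
  then show ?thesis
    using assms by (simp add: tendsto_in_probability_def whp_def not_le)
qed

lemma whp_imp_prob_tendsto_1:
  assumes "whp M E"
  shows "(\<lambda>n. prob {\<omega> \<in> space M. E n \<omega>}) \<longlonglongrightarrow> 1"
proof -
  have "prob {\<omega> \<in> space M. E n \<omega>} = 1 - prob {\<omega> \<in> space M. \<not> E n \<omega>}" for n
  proof -
    have "{\<omega> \<in> space M. \<not> E n \<omega>} = space M - {\<omega> \<in> space M. E n \<omega>}" by auto
    then show ?thesis
      using prob_compl[OF whp_sets[OF assms, of n]] by simp
  qed
  moreover have "(\<lambda>n. 1 - prob {\<omega> \<in> space M. \<not> E n \<omega>}) \<longlonglongrightarrow> 1 - 0"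
    using assms unfolding whp_def by (intro tendsto_diff tendsto_const) blast
  ultimately show ?thesis
    by simp
qed

section \<open>Law of large numbers for rare events\<close>

text \<open>The count is binomial with variance at most \<open>n p n\<close>, its mean. After division by \<open>k n\<close> the
  variance is at most \<open>(n p n / k n) / k n\<close>, which vanishes because the mean \<open>n p n / k n\<close> stays
  bounded. Chebyshev's inequality, which sees the small variance of the summands, then suffices; a bound
  in terms of their range alone would involve \<open>n / (k n)\<^sup>2\<close>, which need not vanish.\<close>

lemma scaled_count_tendsto_in_probability:
  fixes k :: "nat \<Rightarrow> nat"
  assumes indep: "indep_vars (\<lambda>_. N) Z UNIV"
    and A: "\<And>n. A n \<in> sets N"
    and p: "\<And>n i. prob {\<omega> \<in> space M. Z i \<omega> \<in> A n} = p n"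
    and k: "filterlim k at_top sequentially"
    and lim: "(\<lambda>n. real n * p n / real (k n)) \<longlonglongrightarrow> c"
  shows "tendsto_in_probability M (\<lambda>n \<omega>. scaled_count n (k n) (\<lambda>i. Z i \<omega> \<in> A n)) c"
proof -
  have Z: "Z i \<in> measurable M N" for i
    using indep by (auto simp: indep_vars_def)
  note [measurable] = Z A
  let ?W = "\<lambda>n \<omega>. scaled_count n (k n) (\<lambda>i. Z i \<omega> \<in> A n)"
  have meas: "?W n \<in> borel_measurable M" for n
    unfolding scaled_count_def by measurable
  have p_nonneg: "p n \<ge> 0" for n
    using p[of 0 n] by (metis measure_nonneg)
  \<comment> \<open>The centred indicators, whose products have vanishing expectation off the diagonal.\<close>
  define D where "D n i \<omega> = of_bool (Z i \<omega> \<in> A n) - p n" for n i \<omega>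
  have D_meas[measurable]: "D n i \<in> borel_measurable M" for n i
    unfolding D_def by measurable
  have D_bound: "\<bar>D n i \<omega>\<bar> \<le> 1 + p n" for n i \<omega>
    using p_nonneg[of n] by (auto simp: D_def)
  have D_int[simp]: "integrable M (D n i)" for n i
    using D_bound by (intro integrable_const_bound[where B = "1 + p n"]) auto
  have DD_int[simp]: "integrable M (\<lambda>\<omega>. D n i \<omega> * D n j \<omega>)" for n i j
    using p_nonneg[of n]
    by (intro integrable_const_bound[where B = "(1 + p n) * (1 + p n)"])
       (auto simp: abs_mult intro!: mult_mono D_bound)
  have B_int[simp]: "integrable M (\<lambda>\<omega>. of_bool (Z i \<omega> \<in> A n) :: real)" for n i
    by (intro integrable_const_bound[where B = 1]) auto
  have B_exp: "expectation (\<lambda>\<omega>. of_bool (Z i \<omega> \<in> A n)) = p n" for n i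
  proof -
    have "expectation (\<lambda>\<omega>. of_bool (Z i \<omega> \<in> A n))
      = expectation (indicator {\<omega> \<in> space M. Z i \<omega> \<in> A n})"
      by (intro Bochner_Integration.integral_cong) (auto simp: indicator_def)
    also have "\<dots> = prob {\<omega> \<in> space M. Z i \<omega> \<in> A n}"
      by (simp add: Int_def conj_ac cong: conj_cong)
    finally show ?thesis
      by (simp only: p)
  qed
  have D_exp: "expectation (D n i) = 0" for n i
    unfolding D_def by (simp add: B_exp prob_space)
  have D_sq: "expectation (\<lambda>\<omega>. D n i \<omega> * D n i \<omega>) \<le> p n" for n i
  proof -
    have "expectation (\<lambda>\<omega>. D n i \<omega> * D n i \<omega>)
      = expectation (\<lambda>\<omega>. (1 - 2 * p n) * of_bool (Z i \<omega> \<in> A n) + p n * p n)"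
      by (intro Bochner_Integration.integral_cong) (auto simp: D_def algebra_simps)
    also have "\<dots> = p n - p n * p n"
      by (simp add: B_exp prob_space algebra_simps)
    finally show ?thesis by simp
  qed
  have D_cross: "expectation (\<lambda>\<omega>. D n i \<omega> * D n j \<omega>) = 0" if "i \<noteq> j" for n i j
  proof -
    have "indep_vars (\<lambda>_. borel) (\<lambda>i \<omega>. of_bool (Z i \<omega> \<in> A n) - p n) {i, j}"
      by (intro indep_vars_compose2[OF indep_vars_subset[OF indep]]) auto
    then have "indep_vars (\<lambda>_. borel) (D n) {i, j}"
      by (simp add: D_def[abs_def])
    from indep_vars_lebesgue_integral[OF _ this] show ?thesis
      using \<open>i \<noteq> j\<close> D_exp by simp
  qed
  have second_moment: "expectation (\<lambda>\<omega>. (\<Sum>i=1..n. D n i \<omega>)\<^sup>2) \<le> real n * p n" for n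
  proof -
    have "expectation (\<lambda>\<omega>. (\<Sum>i=1..n. D n i \<omega>)\<^sup>2)
      = expectation (\<lambda>\<omega>. \<Sum>i=1..n. \<Sum>j=1..n. D n i \<omega> * D n j \<omega>)"
      by (simp add: power2_eq_square sum_product)
    also have "\<dots> = (\<Sum>i=1..n. \<Sum>j=1..n. expectation (\<lambda>\<omega>. D n i \<omega> * D n j \<omega>))"
      by simp
    also have "\<dots> = (\<Sum>i=1..n. \<Sum>j=1..n. if j = i then expectation (\<lambda>\<omega>. D n i \<omega> * D n i \<omega>) else 0)"
      using D_cross by (intro sum.cong) auto
    also have "\<dots> \<le> (\<Sum>i=1..n. p n)"
      using D_sq by (intro sum_mono) (simp add: sum.delta)
    finally show ?thesis by simp
  qed
  have "whp M (\<lambda>n \<omega>. dist (?W n \<omega>) c \<le> \<epsilon>)" if "\<epsilon> > 0" for \<epsilon>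
  proof -
    \<comment> \<open>Half of \<open>\<epsilon>\<close> pays for the bias; Chebyshev's inequality with deviation \<open>k n * \<epsilon> / 2\<close>
    for the unnormalised sum gives this bound.\<close>
    let ?b = "\<lambda>n. (4 / \<epsilon>\<^sup>2) * ((real n * p n / real (k n)) * inverse (real (k n)))"
    have k_real: "filterlim (\<lambda>n. real (k n)) at_top sequentially"
      by (rule filterlim_compose[OF filterlim_real_sequentially k])
    have "(\<lambda>n. inverse (real (k n))) \<longlonglongrightarrow> 0"
      by (rule tendsto_inverse_0_at_top[OF k_real])
    from tendsto_mult[OF lim this] have b_lim: "?b \<longlonglongrightarrow> 0"
      by (intro tendsto_mult_right_zero) (simp only: mult_zero_right)
    have "\<forall>\<^sub>F n in sequentially. k n \<ge> 1"
      using k by (simp add: filterlim_at_top)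
    moreover have "\<forall>\<^sub>F n in sequentially. dist (real n * p n / real (k n)) c < \<epsilon> / 2"
      using lim \<open>\<epsilon> > 0\<close> by (intro tendstoD) auto
    ultimately have "\<forall>\<^sub>F n in sequentially. prob {\<omega> \<in> space M. \<not> dist (?W n \<omega>) c \<le> \<epsilon>} \<le> ?b n"
    proof eventually_elim
      case (elim n)
      let ?S = "\<lambda>\<omega>. \<Sum>i=1..n. D n i \<omega>"
      have "{\<omega> \<in> space M. \<not> dist (?W n \<omega>) c \<le> \<epsilon>}
          \<subseteq> {\<omega> \<in> space M. (real (k n) * \<epsilon> / 2)\<^sup>2 \<le> (?S \<omega>)\<^sup>2}"
      proof safe
        fix \<omega> assume *: "\<not> dist (?W n \<omega>) c \<le> \<epsilon>"
        have "?W n \<omega> - real n * p n / real (k n) = ?S \<omega> / real (k n)"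
          by (simp add: D_def scaled_count_def sum_subtractf diff_divide_distrib)
        then have "\<epsilon> / 2 < \<bar>?S \<omega> / real (k n)\<bar>"
          using * elim(2) unfolding dist_real_def by linarith
        then have "real (k n) * \<epsilon> / 2 \<le> \<bar>?S \<omega>\<bar>"
          using elim(1) by (simp add: field_simps abs_if split: if_splits)
        then show "(real (k n) * \<epsilon> / 2)\<^sup>2 \<le> (?S \<omega>)\<^sup>2"
          using \<open>\<epsilon> > 0\<close> by (subst abs_le_square_iff[symmetric]) auto
      qed
      then have "prob {\<omega> \<in> space M. \<not> dist (?W n \<omega>) c \<le> \<epsilon>}
          \<le> prob {\<omega> \<in> space M. (real (k n) * \<epsilon> / 2)\<^sup>2 \<le> (?S \<omega>)\<^sup>2}"
        by (intro finite_measure_mono) auto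
      also have "\<dots> \<le> expectation (\<lambda>\<omega>. (?S \<omega>)\<^sup>2) / (real (k n) * \<epsilon> / 2)\<^sup>2"
      proof (rule integral_Markov_inequality_measure[where A = "{}"])
        show "integrable M (\<lambda>\<omega>. (?S \<omega>)\<^sup>2)"
          by (simp add: power2_eq_square sum_product)
      qed (use elim(1) \<open>\<epsilon> > 0\<close> in auto)
      also have "\<dots> \<le> real n * p n / (real (k n) * \<epsilon> / 2)\<^sup>2"
        by (intro divide_right_mono second_moment) auto
      also have "\<dots> = ?b n"
        by (simp add: power2_eq_square field_simps)
      finally show ?case .
    qed
    then have "(\<lambda>n. prob {\<omega> \<in> space M. \<not> dist (?W n \<omega>) c \<le> \<epsilon>}) \<longlonglongrightarrow> 0"
      by (rule tendsto_sandwich[OF always_eventually[OF allI[OF measure_nonneg]] _ tendsto_const b_lim])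
    moreover have "{\<omega> \<in> space M. dist (?W n \<omega>) c \<le> \<epsilon>} \<in> events" for n
      using meas[of n] by measurable
    ultimately show ?thesis
      by (simp add: whp_def)
  qed
  then show ?thesis
    using meas by (simp add: tendsto_in_probability_iff_whp)
qed

end

section \<open>Uniform margins\<close>

text \<open>The distribution function of the uniform law on the unit interval, on the whole line.\<close>

definition clip :: "real \<Rightarrow> real" where
  "clip s = max 0 (min 1 s)"

lemma clip_lipschitz: "\<bar>clip s - clip s'\<bar> \<le> \<bar>s - s'\<bar>"
  by (simp add: clip_def max_def min_def)

lemma clip_nonpos: "s \<le> 0 \<Longrightarrow> clip s = 0"
  and clip_unit: "0 \<le> s \<Longrightarrow> s \<le> 1 \<Longrightarrow> clip s = s"
  by (simp_all add: clip_def)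

context real_distribution
begin

text \<open>The probability integral transform. Since the distribution function may have flat pieces, no
  inverse is used: any quantile \<open>q\<close> of level \<open>a\<close> gives bounds by comparing the event with
  \<open>{..q}\<close>, and letting \<open>a\<close> increase to \<open>c\<close> closes the gap between the strict and the weak inequality.\<close>

lemma prob_cdf_less:
  assumes cont: "\<And>x. isCont (cdf M) x"
  shows "measure M {x. cdf M x < c} = clip c"
proof -
  have meas: "{x. cdf M x < c} \<in> events" for c
    using borel_measurable_mono[of "cdf M"] cdf_nondecreasing by (simp add: mono_def)
  have quantile: "\<exists>q. cdf M q = a" if "0 < a" "a < 1" for a
  proof -
    obtain x where x: "cdf M x \<le> a"
      using eventually_happens[OF order_tendstoD(2)[OF cdf_lim_at_bot \<open>0 < a\<close>]] less_imp_le by auto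
    obtain y where y: "a \<le> cdf M y"
      using eventually_happens[OF order_tendstoD(1)[OF cdf_lim_at_top_prob \<open>a < 1\<close>]] less_imp_le by auto
    show ?thesis
    proof (cases "x \<le> y")
      case True
      then show ?thesis
        using IVT[of "cdf M" x a y] x y cont by auto
    next
      case False
      then show ?thesis
        using cdf_nondecreasing[of y x] x y by (intro exI[of _ x]) auto
    qed
  qed
  have lower: "a \<le> measure M {x. cdf M x < c}" if a: "0 < a" "a < 1" "a < c" for a
  proof -
    obtain q where q: "cdf M q = a"
      using quantile a by blast
    have "{..q} \<subseteq> {x. cdf M x < c}"
      using cdf_nondecreasing[of _ q] q \<open>a < c\<close> by fastforce
    then have "measure M {..q} \<le> measure M {x. cdf M x < c}"
      by (intro finite_measure_mono meas)
    then show ?thesis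
      using q by (simp add: cdf_def2)
  qed
  consider "c \<le> 0" | "0 < c" "c < 1" | "1 \<le> c" by linarith
  then show ?thesis
  proof cases
    case 1
    then have "{x. cdf M x < c} = {}"
      using cdf_nonneg by (auto simp: not_less intro: order.trans)
    then show ?thesis
      using 1 by (simp add: clip_def)
  next
    case 2
    obtain q where q: "cdf M q = c"
      using quantile 2 by blast
    have "{x. cdf M x < c} \<subseteq> {..q}"
      using cdf_nondecreasing[of q] q by (force simp: not_less[symmetric])
    then have "measure M {x. cdf M x < c} \<le> c"
      using finite_measure_mono[of "{x. cdf M x < c}" "{..q}"] q by (simp add: cdf_def2)
    moreover have "c \<le> measure M {x. cdf M x < c}"
      using lower 2 by (intro dense_le_bounded[of 0 c]) auto
    ultimately show ?thesis
      using 2 by (simp add: clip_def)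
  next
    case 3
    then have "1 \<le> measure M {x. cdf M x < c}"
      using lower by (intro dense_le_bounded[of 0 1]) auto
    then show ?thesis
      using 3 prob_le_1[of "{x. cdf M x < c}"] by (simp add: clip_def)
  qed
qed

end

context prob_space
begin

abbreviation survival :: "('a \<Rightarrow> real) \<Rightarrow> real \<Rightarrow> real" where
  "survival V x \<equiv> 1 - cdf (distr M borel V) x"

lemma antimono_survival:
  assumes [measurable]: "V \<in> borel_measurable M"
  shows "antimono (survival V)"
proof -
  interpret D: real_distribution "distr M borel V" by simp
  show ?thesis
    by (intro antimonoI) (simp add: D.cdf_nondecreasing)
qed

lemma survival_nonneg:
  assumes [measurable]: "V \<in> borel_measurable M"
  shows "survival V x \<ge> 0"
proof -
  interpret D: real_distribution "distr M borel V" by simp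
  show ?thesis by (simp add: D.cdf_bounded_prob)
qed

lemma borel_measurable_survival:
  assumes [measurable]: "V \<in> borel_measurable M"
  shows "survival V \<in> borel_measurable borel"
proof -
  have "mono (\<lambda>x. - survival V x)"
    using antimono_survival[OF assms] by (auto simp: antimono_def mono_def)
  from borel_measurable_uminus[OF borel_measurable_mono[OF this]] show ?thesis
    by simp
qed

lemma prob_survival_le:
  assumes V[measurable]: "V \<in> borel_measurable M"
    and null: "\<And>x. prob {\<omega> \<in> space M. V \<omega> = x} = 0"
  shows "prob {\<omega> \<in> space M. survival V (V \<omega>) \<le> s} = clip s"
proof -
  interpret D: real_distribution "distr M borel V" by simp
  have [measurable]: "survival V \<in> borel_measurable borel"
    by (rule borel_measurable_survival) fact
  have cont: "isCont (cdf (distr M borel V)) x" for x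
    using null[of x] by (simp add: D.isCont_cdf measure_distr vimage_def Int_def conj_ac)
  have "{x. survival V x \<le> s} \<in> sets borel" by measurable
  then have "measure (distr M borel V) {x. survival V x \<le> s} = prob (V -` {x. survival V x \<le> s} \<inter> space M)"
    by (intro measure_distr) auto
  also have "V -` {x. survival V x \<le> s} \<inter> space M = {\<omega> \<in> space M. survival V (V \<omega>) \<le> s}" by auto
  finally have "prob {\<omega> \<in> space M. survival V (V \<omega>) \<le> s} = measure (distr M borel V) {x. survival V x \<le> s}" ..
  also have "{x. survival V x \<le> s} = space (distr M borel V) - {x. cdf (distr M borel V) x < 1 - s}"
    by (auto simp: not_less)
  also have "measure (distr M borel V) \<dots> = 1 - clip (1 - s)"
    using borel_measurable_mono[of "cdf (distr M borel V)"] D.cdf_nondecreasing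
    by (subst D.prob_compl) (auto simp: D.prob_cdf_less[OF cont] mono_def)
  also have "\<dots> = clip s"
    by (simp add: clip_def max_def min_def)
  finally show ?thesis .
qed

text \<open>If \<open>V\<close> had an atom at \<open>x\<close>, the event \<open>V = x \<and> W \<le> y\<close> would have positive probability for
  some \<open>y\<close>, and the joint distribution function would jump in its first argument at \<open>(x, y)\<close>.\<close>

lemma prob_fst_eq_0_of_continuous_joint_cdf:
  assumes [measurable]: "V \<in> borel_measurable M" "W \<in> borel_measurable M"
    and cont: "continuous_on UNIV (joint_cdf M V W)"
  shows "prob {\<omega> \<in> space M. V \<omega> = x} = 0"
proof -
  have null: "prob {\<omega> \<in> space M. V \<omega> = x \<and> W \<omega> \<le> y} \<le> 0" for y
  proof -
    have "((\<lambda>h. joint_cdf M V W (x - h, y)) \<longlongrightarrow> joint_cdf M V W (x - 0, y)) (at_right 0)"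
      by (rule continuous_on_tendsto_compose[OF cont])
         (auto intro!: tendsto_eq_intros)
    then have lim: "((\<lambda>h. joint_cdf M V W (x, y) - joint_cdf M V W (x - h, y)) \<longlongrightarrow> 0) (at_right 0)"
      by (auto intro!: tendsto_eq_intros)
    have "prob {\<omega> \<in> space M. V \<omega> = x \<and> W \<omega> \<le> y} \<le> joint_cdf M V W (x, y) - joint_cdf M V W (x - h, y)"
      if "h > 0" for h
    proof -
      let ?E = "{\<omega> \<in> space M. V \<omega> = x \<and> W \<omega> \<le> y}" and ?L = "{\<omega> \<in> space M. V \<omega> \<le> x - h \<and> W \<omega> \<le> y}"
      have "prob ?E + prob ?L = prob (?E \<union> ?L)"
        using that by (intro finite_measure_Union[symmetric]) auto
      also have "\<dots> \<le> prob {\<omega> \<in> space M. V \<omega> \<le> x \<and> W \<omega> \<le> y}"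
        using that by (intro finite_measure_mono) auto
      finally show ?thesis by (simp add: joint_cdf_def)
    qed
    then show ?thesis
      by (intro tendsto_lowerbound[OF lim]) (auto simp: eventually_at_right_less intro: eventually_at_rightI[of 0 1])
  qed
  have "AE \<omega> in M. \<forall>m::nat. \<not> (V \<omega> = x \<and> W \<omega> \<le> real m)"
    unfolding AE_all_countable
  proof
    fix m :: nat
    have "prob {\<omega> \<in> space M. V \<omega> = x \<and> W \<omega> \<le> real m} = 0"
      using null by (simp add: antisym)
    then show "AE \<omega> in M. \<not> (V \<omega> = x \<and> W \<omega> \<le> real m)"
      by (subst (asm) prob_eq_0) auto
  qed
  then have "AE \<omega> in M. \<not> V \<omega> = x"
    by eventually_elim (use real_arch_simple in blast)
  then show ?thesis
    by (subst prob_eq_0) auto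
qed

lemma prob_snd_eq_0_of_continuous_joint_cdf:
  assumes "V \<in> borel_measurable M" "W \<in> borel_measurable M"
    and cont: "continuous_on UNIV (joint_cdf M V W)"
  shows "prob {\<omega> \<in> space M. W \<omega> = y} = 0"
proof (rule prob_fst_eq_0_of_continuous_joint_cdf[OF assms(2,1)])
  have "joint_cdf M W V = (\<lambda>z. joint_cdf M V W (prod.swap z))"
    by (auto simp: joint_cdf_def fun_eq_iff conj_commute)
  then show "continuous_on UNIV (joint_cdf M W V)"
    by (auto simp: prod.swap_def intro!: continuous_on_compose2[OF cont] continuous_intros)
qed

text \<open>The lower left quadrants generate the Borel sets of the plane and are closed under
  intersection.\<close>

lemma joint_distr_eqI:
  assumes [measurable]: "V \<in> borel_measurable M" "W \<in> borel_measurable M"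
    "V' \<in> borel_measurable M" "W' \<in> borel_measurable M"
    and eq: "joint_cdf M V W = joint_cdf M V' W'"
  shows "distr M borel (\<lambda>\<omega>. (V \<omega>, W \<omega>)) = distr M borel (\<lambda>\<omega>. (V' \<omega>, W' \<omega>))"
proof (rule measure_eqI_generator_eq[where E = "range (\<lambda>a. {..a :: real \<times> real})"
      and \<Omega> = UNIV and A = "\<lambda>m. {..(real m, real m)}"])
  have gen: "distr M borel (\<lambda>\<omega>. (P \<omega>, Q \<omega>)) {..a} = ennreal (joint_cdf M P Q a)"
    if [measurable]: "P \<in> borel_measurable M" "Q \<in> borel_measurable M" for P Q and a :: "real \<times> real"
  proof -
    have "(\<lambda>\<omega>. (P \<omega>, Q \<omega>)) -` {..a} \<inter> space M = {\<omega> \<in> space M. P \<omega> \<le> fst a \<and> Q \<omega> \<le> snd a}"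
      by (auto simp: less_eq_prod_def)
    then show ?thesis
      by (subst emeasure_distr) (auto simp: emeasure_eq_measure joint_cdf_def case_prod_unfold)
  qed
  show "emeasure (distr M borel (\<lambda>\<omega>. (V \<omega>, W \<omega>))) X = emeasure (distr M borel (\<lambda>\<omega>. (V' \<omega>, W' \<omega>))) X"
    if "X \<in> range (\<lambda>a. {..a :: real \<times> real})" for X
    using that eq by (auto simp: gen)
  show "Int_stable (range (\<lambda>a. {..a :: real \<times> real}))"
    unfolding Int_stable_def
  proof safe
    fix a b c d :: real
    have "{..(a, b)} \<inter> {..(c, d)} = {..(min a c, min b d)}"
      by (auto simp: less_eq_prod_def)
    then show "{..(a, b)} \<inter> {..(c, d)} \<in> range (\<lambda>a. {..a :: real \<times> real})" by auto
  qed
  show "(\<Union>m. {..(real m, real m)}) = (UNIV :: (real \<times> real) set)"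
  proof safe
    fix a b :: real
    obtain m :: nat where "max a b \<le> real m"
      using real_arch_simple by blast
    then show "(a, b) \<in> (\<Union>m. {..(real m, real m)})"
      by (auto simp: less_eq_prod_def)
  qed auto
  show "emeasure (distr M borel (\<lambda>\<omega>. (V \<omega>, W \<omega>))) {..(real m, real m)} \<noteq> \<infinity>" for m
    by (simp add: gen)
qed (auto simp: borel_eq_atMost)

end

section \<open>The tail dependence function\<close>

lemma measurable_fst_snd_plane[measurable]:
  "(fst :: real \<times> real \<Rightarrow> real) \<in> borel_measurable borel"
  "(snd :: real \<times> real \<Rightarrow> real) \<in> borel_measurable borel"
  by (simp_all add: borel_measurable_continuous_onI continuous_on_fst continuous_on_snd continuous_on_id)

text \<open>The nonparametric part of the model: \<open>l\<close> is the tail dependence function at the true parameter.\<close>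

locale tail_sample = prob_space M for M :: "'a measure" +
  fixes X Y :: "nat \<Rightarrow> 'a \<Rightarrow> real" and F :: "real \<times> real \<Rightarrow> real"
    and l :: "real \<Rightarrow> real \<Rightarrow> real" and k :: "nat \<Rightarrow> nat"
  assumes indep: "indep_vars (\<lambda>_. borel) (\<lambda>i \<omega>. (X i \<omega>, Y i \<omega>)) UNIV"
    and joint_cdf: "\<And>i. joint_cdf M (X i) (Y i) = F"
    and continuous_F: "continuous_on UNIV F"
    and stdf: "has_stdf M (X 0) (Y 0) l"
    and k_range: "\<And>n. n \<ge> 1 \<Longrightarrow> k n \<in> {1..n}"
    and k_at_top: "filterlim k at_top sequentially"
    and k_over_n: "(\<lambda>n. real (k n) / real n) \<longlonglongrightarrow> 0"
begin

lemma measurable_XY: "(\<lambda>\<omega>. (X i \<omega>, Y i \<omega>)) \<in> borel_measurable M"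
  using indep by (auto simp: indep_vars_def)

lemma measurable_X[measurable]: "X i \<in> borel_measurable M"
  and measurable_Y[measurable]: "Y i \<in> borel_measurable M"
  using measurable_compose[OF measurable_XY[of i], of fst borel]
    measurable_compose[OF measurable_XY[of i], of snd borel]
  by (simp_all add: borel_measurable_continuous_onI continuous_on_fst continuous_on_snd continuous_on_id)

definition S where "S = survival (X 0)"
definition T where "T = survival (Y 0)"

lemma S_T_antimono: "antimono S" "antimono T"
  unfolding S_def T_def by (intro antimono_survival measurable_X measurable_Y)+

lemma S_T_nonneg: "S x \<ge> 0" "T x \<ge> 0"
  unfolding S_def T_def using survival_nonneg measurable_X measurable_Y by auto

lemma measurable_S_T[measurable]: "S \<in> borel_measurable borel" "T \<in> borel_measurable borel"
  unfolding S_def T_def by (intro borel_measurable_survival measurable_X measurable_Y)+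

lemma prob_sample_eq_0:
  "prob {\<omega> \<in> space M. X i \<omega> = x} = 0" "prob {\<omega> \<in> space M. Y i \<omega> = y} = 0"
  using prob_fst_eq_0_of_continuous_joint_cdf[of "X i" "Y i"]
    prob_snd_eq_0_of_continuous_joint_cdf[of "X i" "Y i"] continuous_F
  by (simp_all add: joint_cdf)

lemma prob_sample_transfer:
  assumes "A \<in> sets borel"
  shows "prob {\<omega> \<in> space M. (X i \<omega>, Y i \<omega>) \<in> A} = prob {\<omega> \<in> space M. (X 0 \<omega>, Y 0 \<omega>) \<in> A}"
proof -
  have "measure (distr M borel (\<lambda>\<omega>. (X i \<omega>, Y i \<omega>))) A = prob {\<omega> \<in> space M. (X i \<omega>, Y i \<omega>) \<in> A}" for i
    using assms measurable_XY[of i] by (simp add: measure_distr vimage_def Int_def conj_commute)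
  moreover have "distr M borel (\<lambda>\<omega>. (X i \<omega>, Y i \<omega>)) = distr M borel (\<lambda>\<omega>. (X 0 \<omega>, Y 0 \<omega>))"
    by (rule joint_distr_eqI) (simp_all add: joint_cdf)
  ultimately show ?thesis by metis
qed

text \<open>With \<open>S\<close> and \<open>T\<close> the marginal survival functions, \<open>l\<close> is the limit of
  \<open>tail_prob (t x) (t y) / t\<close> as \<open>t\<close> decreases to zero.\<close>

definition tail_prob :: "real \<Rightarrow> real \<Rightarrow> real" where
  "tail_prob s t = prob {\<omega> \<in> space M. S (X 0 \<omega>) \<le> s \<or> T (Y 0 \<omega>) \<le> t}"

lemma prob_margin:
  "prob {\<omega> \<in> space M. S (X 0 \<omega>) \<le> s} = clip s" "prob {\<omega> \<in> space M. T (Y 0 \<omega>) \<le> t} = clip t"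
  unfolding S_def T_def by (intro prob_survival_le prob_sample_eq_0 measurable_X measurable_Y)+

lemma tail_prob_mono: "s \<le> s' \<Longrightarrow> t \<le> t' \<Longrightarrow> tail_prob s t \<le> tail_prob s' t'"
  unfolding tail_prob_def by (intro finite_measure_mono) auto

text \<open>Enlarging a union adds at most what is added to each of its two members, and the members have
  the probabilities of uniform variables.\<close>

lemma tail_prob_increment:
  assumes "s \<le> s'" "t \<le> t'"
  shows "tail_prob s' t' - tail_prob s t \<le> (clip s' - clip s) + (clip t' - clip t)"
proof -
  let ?A = "\<lambda>s. {\<omega> \<in> space M. S (X 0 \<omega>) \<le> s}" and ?B = "\<lambda>t. {\<omega> \<in> space M. T (Y 0 \<omega>) \<le> t}"
  have E: "tail_prob s t = prob (?A s \<union> ?B t)" for s t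
    unfolding tail_prob_def by (rule arg_cong[where f = prob]) auto
  have "?A s \<subseteq> ?A s'" "?B t \<subseteq> ?B t'"
    using assms by auto
  then have "tail_prob s' t' - tail_prob s t = prob ((?A s' \<union> ?B t') - (?A s \<union> ?B t))"
    unfolding E by (intro finite_measure_Diff[symmetric]) auto
  also have "\<dots> \<le> prob ((?A s' - ?A s) \<union> (?B t' - ?B t))"
    by (intro finite_measure_mono) auto
  also have "\<dots> \<le> prob (?A s' - ?A s) + prob (?B t' - ?B t)"
    by (intro measure_Un_le) auto
  also have "\<dots> = (prob (?A s') - prob (?A s)) + (prob (?B t') - prob (?B t))"
    using \<open>?A s \<subseteq> ?A s'\<close> \<open>?B t \<subseteq> ?B t'\<close> by (subst (1 2) finite_measure_Diff) auto
  finally show ?thesis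
    by (simp only: prob_margin)
qed

lemma tail_prob_lipschitz:
  "\<bar>tail_prob s t - tail_prob s' t'\<bar> \<le> \<bar>clip s - clip s'\<bar> + \<bar>clip t - clip t'\<bar>"
proof -
  have step: "tail_prob (max s s') (max t t') - tail_prob (min s s') (min t t')
      \<le> (clip (max s s') - clip (min s s')) + (clip (max t t') - clip (min t t'))"
    by (intro tail_prob_increment) auto
  have "clip (max s s') - clip (min s s') = \<bar>clip s - clip s'\<bar>" for s s'
    by (auto simp: clip_def max_def min_def)
  with step have "tail_prob (max s s') (max t t') - tail_prob (min s s') (min t t')
      \<le> \<bar>clip s - clip s'\<bar> + \<bar>clip t - clip t'\<bar>" by simp
  moreover have "tail_prob (min s s') (min t t') \<le> tail_prob s t" "tail_prob s t \<le> tail_prob (max s s') (max t t')"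
    "tail_prob (min s s') (min t t') \<le> tail_prob s' t'" "tail_prob s' t' \<le> tail_prob (max s s') (max t t')"
    by (intro tail_prob_mono; simp)+
  ultimately show ?thesis by linarith
qed

text \<open>The estimator at \<open>(x, y)\<close> is compared with thresholds slightly below \<open>x\<close> and \<open>y\<close>, which are
  negative near the axes. Extending \<open>l\<close> constantly across the axes keeps the limit and the
  Lipschitz bound valid on the whole plane.\<close>

definition L :: "real \<Rightarrow> real \<Rightarrow> real" where
  "L x y = l (max 0 x) (max 0 y)"

lemma L_eq: "x \<ge> 0 \<Longrightarrow> y \<ge> 0 \<Longrightarrow> L x y = l x y"
  by (simp add: L_def)

text \<open>Passing from \<open>x\<close> to \<open>max 0 x\<close> changes neither marginal probability, hence by the
  Lipschitz bound not the probability of the union: the events \<open>S (X 0) \<le> t x\<close> are null for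
  \<open>x \<le> 0\<close>.\<close>

lemma tail_prob_scaled_tendsto_L:
  "((\<lambda>t. inverse t * tail_prob (t * x) (t * y)) \<longlongrightarrow> L x y) (at_right 0)"
proof -
  have lim: "((\<lambda>t. inverse t * tail_prob (t * max 0 x) (t * max 0 y)) \<longlongrightarrow> L x y) (at_right 0)"
    using stdf unfolding has_stdf_def tail_prob_def S_def T_def L_def
    by (simp del: max.bounded_iff)
  have "tail_prob (t * max 0 x) (t * max 0 y) = tail_prob (t * x) (t * y)" if "t > 0" for t
  proof -
    have "clip (t * max 0 x) = clip (t * x)" for x
      using that by (cases "x \<ge> 0") (auto simp: clip_nonpos mult_nonneg_nonpos max_def)
    then show ?thesis
      using tail_prob_lipschitz[of "t * max 0 x" "t * max 0 y" "t * x" "t * y"] by simp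
  qed
  then have "\<forall>\<^sub>F t in at_right 0. inverse t * tail_prob (t * max 0 x) (t * max 0 y)
      = inverse t * tail_prob (t * x) (t * y)"
    by (intro eventually_at_rightI[of 0 1]) auto
  from Lim_transform_eventually[OF lim this] show ?thesis .
qed

lemma L_lipschitz: "\<bar>L x y - L x' y'\<bar> \<le> \<bar>x - x'\<bar> + \<bar>y - y'\<bar>"
proof (rule tendsto_upperbound)
  show "((\<lambda>t. \<bar>inverse t * tail_prob (t * x) (t * y) - inverse t * tail_prob (t * x') (t * y')\<bar>)
      \<longlongrightarrow> \<bar>L x y - L x' y'\<bar>) (at_right 0)"
    by (intro tendsto_intros tail_prob_scaled_tendsto_L)
  have "\<bar>inverse t * tail_prob (t * x) (t * y) - inverse t * tail_prob (t * x') (t * y')\<bar>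
      \<le> \<bar>x - x'\<bar> + \<bar>y - y'\<bar>" if "t > 0" for t
  proof -
    have "\<bar>tail_prob (t * x) (t * y) - tail_prob (t * x') (t * y')\<bar>
      \<le> \<bar>t * x - t * x'\<bar> + \<bar>t * y - t * y'\<bar>"
      using tail_prob_lipschitz[of "t * x" "t * y" "t * x'" "t * y'"]
        clip_lipschitz[of "t * x" "t * x'"] clip_lipschitz[of "t * y" "t * y'"] by linarith
    also have "\<dots> = t * (\<bar>x - x'\<bar> + \<bar>y - y'\<bar>)"
      using that by (simp add: right_diff_distrib[symmetric] abs_mult distrib_left)
    finally have "inverse t * \<bar>tail_prob (t * x) (t * y) - tail_prob (t * x') (t * y')\<bar>
      \<le> inverse t * (t * (\<bar>x - x'\<bar> + \<bar>y - y'\<bar>))"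
      using that by (intro mult_left_mono) auto
    also have "\<dots> = \<bar>x - x'\<bar> + \<bar>y - y'\<bar>"
      using that by simp
    finally show ?thesis
      using that by (simp only: right_diff_distrib[symmetric] abs_mult) simp
  qed
  then show "\<forall>\<^sub>F t in at_right 0. \<bar>inverse t * tail_prob (t * x) (t * y)
      - inverse t * tail_prob (t * x') (t * y')\<bar> \<le> \<bar>x - x'\<bar> + \<bar>y - y'\<bar>"
    by (intro eventually_at_rightI[of 0 1]) auto
qed (simp add: trivial_limit_at_right_real)

section \<open>Pointwise consistency\<close>

text \<open>The threshold on the uniform scale that about \<open>k n * x\<close> of the \<open>n\<close> points fall below.\<close>

definition level :: "nat \<Rightarrow> real \<Rightarrow> real" where
  "level n x = (real (k n) / real n) * x"

lemma k_over_n_at_right: "filterlim (\<lambda>n. real (k n) / real n) (at_right 0) sequentially"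
proof -
  have "\<forall>\<^sub>F n in sequentially. real (k n) / real n \<in> {0<..} \<and> real (k n) / real n \<noteq> 0"
    using eventually_ge_at_top[of 1] by eventually_elim (use k_range in force)
  then show ?thesis
    unfolding filterlim_at using k_over_n by blast
qed

text \<open>The estimator that knows the margins: its mean is \<open>tail_prob (t x) (t y) / t\<close> at
  \<open>t = k n / n\<close>, which tends to zero from the right.\<close>

lemma oracle_tendsto:
  "tendsto_in_probability M
     (\<lambda>n \<omega>. scaled_count n (k n) (\<lambda>i. S (X i \<omega>) \<le> level n x \<or> T (Y i \<omega>) \<le> level n y)) (L x y)"
proof -
  let ?A = "\<lambda>n. {z. S (fst z) \<le> level n x \<or> T (snd z) \<le> level n y}"
  have sets: "?A n \<in> sets borel" for n
    by measurable
  have "prob {\<omega> \<in> space M. (X i \<omega>, Y i \<omega>) \<in> ?A n} = tail_prob (level n x) (level n y)" for i n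
    using prob_sample_transfer[OF sets] by (simp add: tail_prob_def)
  moreover have "(\<lambda>n. real n * tail_prob (level n x) (level n y) / real (k n)) \<longlonglongrightarrow> L x y"
    using filterlim_compose[OF tail_prob_scaled_tendsto_L[of x y] k_over_n_at_right]
    by (simp add: level_def field_simps)
  ultimately show ?thesis
    using scaled_count_tendsto_in_probability[OF indep sets _ k_at_top] by simp
qed

lemma margin_count_tendsto:
  "tendsto_in_probability M (\<lambda>n \<omega>. scaled_count n (k n) (\<lambda>i. S (X i \<omega>) \<le> level n x)) (max 0 x)"
  "tendsto_in_probability M (\<lambda>n \<omega>. scaled_count n (k n) (\<lambda>i. T (Y i \<omega>) \<le> level n x)) (max 0 x)"
proof -
  have small: "\<forall>\<^sub>F n in sequentially. level n x < 1"
    unfolding level_def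
    by (rule order_tendstoD(2)[OF tendsto_mult_left_zero[OF k_over_n]]) simp
  have "\<forall>\<^sub>F n in sequentially. real n * clip (level n x) / real (k n) = max 0 x"
    using small eventually_ge_at_top[of 1]
  proof eventually_elim
    case (elim n)
    then have "k n > 0" using k_range[of n] by simp
    then show ?case
      using elim by (cases "x \<ge> 0")
        (auto simp: level_def clip_nonpos clip_unit mult_nonneg_nonpos divide_nonpos_nonneg max_def)
  qed
  then have lim: "(\<lambda>n. real n * clip (level n x) / real (k n)) \<longlonglongrightarrow> max 0 x"
    by (rule tendsto_eventually)
  let ?A = "\<lambda>n. {z :: real \<times> real. S (fst z) \<le> level n x}"
  let ?B = "\<lambda>n. {z :: real \<times> real. T (snd z) \<le> level n x}"
  have A: "?A n \<in> sets borel" and B: "?B n \<in> sets borel" for n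
    by measurable
  have "prob {\<omega> \<in> space M. (X i \<omega>, Y i \<omega>) \<in> ?A n} = clip (level n x)"
    "prob {\<omega> \<in> space M. (X i \<omega>, Y i \<omega>) \<in> ?B n} = clip (level n x)" for i n
    using prob_sample_transfer[OF A] prob_sample_transfer[OF B] prob_margin by simp_all
  then show "tendsto_in_probability M (\<lambda>n \<omega>. scaled_count n (k n) (\<lambda>i. S (X i \<omega>) \<le> level n x)) (max 0 x)"
    "tendsto_in_probability M (\<lambda>n \<omega>. scaled_count n (k n) (\<lambda>i. T (Y i \<omega>) \<le> level n x)) (max 0 x)"
    using scaled_count_tendsto_in_probability[OF indep A _ k_at_top lim]
      scaled_count_tendsto_in_probability[OF indep B _ k_at_top lim] by simp_all
qed

end

section \<open>Measurability of rank statistics\<close>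

text \<open>The empirical tail dependence function depends on the sample only through the outcomes of the
  finitely many comparisons within each coordinate. It thus takes finitely many values, each on a
  measurable set, and any function of it whatsoever is measurable. This covers uniform
  closeness on the unit square, the event that the empirical moment lies in the range of \<open>\<phi>\<close>, and the estimator.\<close>

lemma measurable_emp_stdf_functional:
  assumes [measurable]: "\<And>i. X i \<in> borel_measurable M" "\<And>i. Y i \<in> borel_measurable M"
    and H: "\<And>f. H f \<in> space N"
  shows "(\<lambda>\<omega>. H (emp_stdf n k (\<lambda>i. X i \<omega>) (\<lambda>i. Y i \<omega>))) \<in> measurable M N"
proof -
  let ?I = "{1..n} \<times> {1..n}"
  \<comment> \<open>All that the ranks of a sample depend on.\<close>
  define R where "R u = {(i, j) \<in> ?I. u j \<le> u i}" for u :: "nat \<Rightarrow> real"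
  define G :: "(nat \<times> nat) set \<times> (nat \<times> nat) set \<Rightarrow> real \<Rightarrow> real \<Rightarrow> real" where
    "G = (\<lambda>(P, Q) x y. (1 / real k) * (\<Sum>i = 1..n. of_bool
      (real (card {j. (i, j) \<in> P}) > real n + 1/2 - real k * x \<or>
       real (card {j. (i, j) \<in> Q}) > real n + 1/2 - real k * y)))"
  have rank: "sample_rank n u i = card {j. (i, j) \<in> R u}" if "i \<in> {1..n}" for u i
    using that by (auto simp: sample_rank_def R_def intro!: arg_cong[where f = card])
  have emp: "emp_stdf n k u v = G (R u, R v)" for u v
    unfolding emp_stdf_def G_def prod.case
    by (intro ext arg_cong2[where f = "(*)"] sum.cong refl) (simp add: rank)
  have R_sets: "{\<omega> \<in> space M. R (\<lambda>i. V i \<omega>) = P} \<in> sets M"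
    if [measurable]: "\<And>i. V i \<in> borel_measurable M" and "P \<in> Pow ?I" for V :: "nat \<Rightarrow> 'a \<Rightarrow> real" and P
  proof -
    have "R (\<lambda>i. V i \<omega>) = P \<longleftrightarrow> (\<forall>z\<in>?I. (V (snd z) \<omega> \<le> V (fst z) \<omega>) = (z \<in> P))" for \<omega>
      using \<open>P \<in> Pow ?I\<close> unfolding R_def by (auto; blast)
    then show ?thesis by simp
  qed
  have "(\<lambda>\<omega>. (R (\<lambda>i. X i \<omega>), R (\<lambda>i. Y i \<omega>))) \<in> measurable M (count_space (Pow ?I \<times> Pow ?I))"
  proof (subst measurable_count_space_eq2, simp, intro conjI ballI)
    fix PQ assume "PQ \<in> Pow ?I \<times> Pow ?I"
    then have "{\<omega> \<in> space M. R (\<lambda>i. X i \<omega>) = fst PQ} \<inter> {\<omega> \<in> space M. R (\<lambda>i. Y i \<omega>) = snd PQ} \<in> sets M"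
      by (intro sets.Int R_sets) auto
    also have "{\<omega> \<in> space M. R (\<lambda>i. X i \<omega>) = fst PQ} \<inter> {\<omega> \<in> space M. R (\<lambda>i. Y i \<omega>) = snd PQ}
      = (\<lambda>\<omega>. (R (\<lambda>i. X i \<omega>), R (\<lambda>i. Y i \<omega>))) -` {PQ} \<inter> space M"
      by auto
    finally show "(\<lambda>\<omega>. (R (\<lambda>i. X i \<omega>), R (\<lambda>i. Y i \<omega>))) -` {PQ} \<inter> space M \<in> sets M" .
  qed (auto simp: R_def)
  from measurable_compose[OF this, of "\<lambda>z. H (G z)" N] show ?thesis
    using H by (simp add: emp)
qed

context tail_sample
begin

abbreviation emp :: "nat \<Rightarrow> 'a \<Rightarrow> real \<Rightarrow> real \<Rightarrow> real" where
  "emp n \<omega> \<equiv> emp_stdf n (k n) (\<lambda>i. X i \<omega>) (\<lambda>i. Y i \<omega>)"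

lemma sets_emp: "{\<omega> \<in> space M. P (emp n \<omega>)} \<in> events"
  using measurable_emp_stdf_functional[of X M Y P "count_space UNIV" n "k n"]
  by (simp add: pred_def)

lemma k_pos: "\<forall>\<^sub>F n in sequentially. k n > 0"
  using eventually_ge_at_top[of 1] by eventually_elim (use k_range in force)

text \<open>With \<open>\<delta> = \<epsilon> / 3\<close>, the marginal counts at \<open>x - \<delta>\<close> and \<open>x + \<delta>\<close> fall on either side of \<open>x\<close>
  with high probability, so the rank thresholds lie between deterministic ones and the
  estimator lies between the two oracle estimators. Those are within \<open>\<delta>\<close> of the values of
  \<open>L\<close>, which themselves are within \<open>2 \<delta>\<close> of \<open>L x y\<close>.\<close>

lemma emp_pointwise_whp:
  assumes "x \<ge> 0" "y \<ge> 0" "\<epsilon> > 0"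
  shows "whp M (\<lambda>n \<omega>. \<bar>emp n \<omega> x y - L x y\<bar> \<le> \<epsilon>)"
proof -
  define \<delta> where "\<delta> = \<epsilon> / 3"
  have "\<delta> > 0" using assms by (simp add: \<delta>_def)
  define CX where "CX n \<omega> a = scaled_count n (k n) (\<lambda>i. S (X i \<omega>) \<le> level n a)" for n \<omega> a
  define CY where "CY n \<omega> b = scaled_count n (k n) (\<lambda>i. T (Y i \<omega>) \<le> level n b)" for n \<omega> b
  define W where "W n \<omega> a b = scaled_count n (k n) (\<lambda>i. S (X i \<omega>) \<le> level n a \<or> T (Y i \<omega>) \<le> level n b)"
    for n \<omega> a b
  have whp_of: "whp M (\<lambda>n \<omega>. \<bar>Z n \<omega> - c\<bar> \<le> \<delta>)" if "tendsto_in_probability M Z c" for Z :: "nat \<Rightarrow> 'a \<Rightarrow> real" and c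
    using that tendsto_in_probability_iff_whp[of Z c] \<open>\<delta> > 0\<close>
    by (auto simp: dist_real_def tendsto_in_probability_def[of M Z c])
  define G where "G n \<omega> \<longleftrightarrow>
      (\<bar>CX n \<omega> (x + \<delta>) - max 0 (x + \<delta>)\<bar> \<le> \<delta> \<and> \<bar>CX n \<omega> (x - \<delta>) - max 0 (x - \<delta>)\<bar> \<le> \<delta>) \<and>
      (\<bar>CY n \<omega> (y + \<delta>) - max 0 (y + \<delta>)\<bar> \<le> \<delta> \<and> \<bar>CY n \<omega> (y - \<delta>) - max 0 (y - \<delta>)\<bar> \<le> \<delta>) \<and>
      (\<bar>W n \<omega> (x + \<delta>) (y + \<delta>) - L (x + \<delta>) (y + \<delta>)\<bar> \<le> \<delta> \<and>
       \<bar>W n \<omega> (x - \<delta>) (y - \<delta>) - L (x - \<delta>) (y - \<delta>)\<bar> \<le> \<delta>)"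
    for n \<omega>
  have "whp M G"
    unfolding G_def[abs_def] CX_def CY_def W_def
    by (intro whp_conj whp_of margin_count_tendsto oracle_tendsto)
  then show ?thesis
  proof (rule whp_mono)
    show "{\<omega> \<in> space M. \<bar>emp n \<omega> x y - L x y\<bar> \<le> \<epsilon>} \<in> events" for n
      by (rule sets_emp)
    show "\<forall>\<^sub>F n in sequentially. \<forall>\<omega>\<in>space M. G n \<omega> \<longrightarrow> \<bar>emp n \<omega> x y - L x y\<bar> \<le> \<epsilon>"
      using k_pos eventually_gt_at_top[of 0]
    proof (eventually_elim, intro ballI impI)
      fix n \<omega>
      assume k: "k n > 0" and n: "n > 0" and "G n \<omega>"
      then have CXp: "\<bar>CX n \<omega> (x + \<delta>) - max 0 (x + \<delta>)\<bar> \<le> \<delta>" and CXm: "\<bar>CX n \<omega> (x - \<delta>) - max 0 (x - \<delta>)\<bar> \<le> \<delta>"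
        and CYp: "\<bar>CY n \<omega> (y + \<delta>) - max 0 (y + \<delta>)\<bar> \<le> \<delta>" and CYm: "\<bar>CY n \<omega> (y - \<delta>) - max 0 (y - \<delta>)\<bar> \<le> \<delta>"
        and Wp: "\<bar>W n \<omega> (x + \<delta>) (y + \<delta>) - L (x + \<delta>) (y + \<delta>)\<bar> \<le> \<delta>"
        and Wm: "\<bar>W n \<omega> (x - \<delta>) (y - \<delta>) - L (x - \<delta>) (y - \<delta>)\<bar> \<le> \<delta>"
        by (simp_all only: G_def)
      have half: "1 / (2 * real (k n)) > 0"
        using k by simp
      \<comment> \<open>For \<open>x < \<delta>\<close> the lower bound needs an empty count at \<open>x - \<delta>\<close>, not just one
      close to zero, because \<open>x\<close> itself may vanish.\<close>
      have zero: "CX n \<omega> a = 0" "CY n \<omega> a = 0" if "a < 0" for a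
      proof -
        have "level n a < 0"
          using that k n by (simp add: level_def mult_pos_neg divide_neg_pos)
        then have "\<not> S b \<le> level n a" "\<not> T b \<le> level n a" for b
          using S_T_nonneg[of b] by linarith+
        then show "CX n \<omega> a = 0" "CY n \<omega> a = 0"
          by (simp_all add: CX_def CY_def scaled_count_def)
      qed
      have "CX n \<omega> (x - \<delta>) \<le> x" "CY n \<omega> (y - \<delta>) \<le> y"
        using CXm CYm zero[of "x - \<delta>"] zero[of "y - \<delta>"] assms by (auto simp: max_def split: if_splits)
      then have "W n \<omega> (x - \<delta>) (y - \<delta>) \<le> emp n \<omega> x y"
        unfolding CX_def CY_def W_def using half k
        by (intro scaled_count_le_emp_stdf S_T_antimono) linarith+
      moreover have "x \<le> CX n \<omega> (x + \<delta>)" "y \<le> CY n \<omega> (y + \<delta>)"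
        using CXp CYp assms \<open>\<delta> > 0\<close> by (auto simp: max_def split: if_splits)
      then have "emp n \<omega> x y \<le> W n \<omega> (x + \<delta>) (y + \<delta>)"
        unfolding CX_def CY_def W_def using half k
        by (intro emp_stdf_le_scaled_count S_T_antimono) linarith+
      moreover have "\<bar>L (x + \<delta>) (y + \<delta>) - L x y\<bar> \<le> 2 * \<delta>" "\<bar>L (x - \<delta>) (y - \<delta>) - L x y\<bar> \<le> 2 * \<delta>"
        using L_lipschitz[of "x + \<delta>" "y + \<delta>" x y] L_lipschitz[of "x - \<delta>" "y - \<delta>" x y] \<open>\<delta> > 0\<close> by simp_all
      moreover have "\<epsilon> = 3 * \<delta>" by (simp add: \<delta>_def)
      ultimately show "\<bar>emp n \<omega> x y - L x y\<bar> \<le> \<epsilon>"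
        using Wp Wm by linarith
    qed
  qed
qed

section \<open>Uniform consistency\<close>

text \<open>The estimator is nondecreasing in both arguments and the limit is Lipschitz continuous, so
  closeness at the points of a finite grid implies closeness everywhere.\<close>

lemma emp_uniform_whp:
  assumes "\<epsilon> > 0"
  shows "whp M (\<lambda>n \<omega>. \<forall>x\<in>{0..1}. \<forall>y\<in>{0..1}. \<bar>emp n \<omega> x y - L x y\<bar> \<le> \<epsilon>)"
proof -
  \<comment> \<open>Within a cell of the grid of mesh \<open>1 / m\<close> the limit varies by at most \<open>2 / m\<close>. The index \<open>Suc m\<close>
    is needed because the cell to the right of the point 1 is used for that point.\<close>
  obtain m :: nat where m: "m > 0" "1 / real m < \<epsilon> / 4"
    using real_arch_inverse[of "\<epsilon> / 4"] assms by (auto simp: inverse_eq_divide)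
  let ?I = "{0..Suc m} \<times> {0..Suc m}"
  have "whp M (\<lambda>n \<omega>. \<forall>z\<in>?I.
      \<bar>emp n \<omega> (real (fst z) / real m) (real (snd z) / real m)
        - L (real (fst z) / real m) (real (snd z) / real m)\<bar> \<le> \<epsilon> / 2)"
    using assms by (intro whp_finite_Ball emp_pointwise_whp) auto
  then show ?thesis
  proof (rule whp_mono, goal_cases)
    case (1 n)
    show ?case by (rule sets_emp)
  next
    case 2
    show ?case
    proof (intro always_eventually allI ballI impI)
      fix n \<omega> and x y :: real
      assume grid: "\<forall>z\<in>?I. \<bar>emp n \<omega> (real (fst z) / real m) (real (snd z) / real m)
          - L (real (fst z) / real m) (real (snd z) / real m)\<bar> \<le> \<epsilon> / 2"
        and x: "x \<in> {0..1}" and y: "y \<in> {0..1}"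
      have cell: "\<exists>i \<le> m. real i / real m \<le> a \<and> a \<le> real (Suc i) / real m" if "a \<in> {0..1}" for a
      proof (intro exI conjI)
        have "real m * a \<le> real m * 1"
          using that by (intro mult_left_mono) auto
        then show "nat \<lfloor>real m * a\<rfloor> \<le> m" by linarith
        have "0 \<le> real m * a" using that by simp
        then have "real (nat \<lfloor>real m * a\<rfloor>) \<le> real m * a" "real m * a \<le> real (Suc (nat \<lfloor>real m * a\<rfloor>))"
          by linarith+
        then show "real (nat \<lfloor>real m * a\<rfloor>) / real m \<le> a" "a \<le> real (Suc (nat \<lfloor>real m * a\<rfloor>)) / real m"
          using m by (simp_all add: field_simps)
      qed
      obtain i where i: "i \<le> m" "real i / real m \<le> x" "x \<le> real (Suc i) / real m"
        using cell[OF x] by blast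
      obtain j where j: "j \<le> m" "real j / real m \<le> y" "y \<le> real (Suc j) / real m"
        using cell[OF y] by blast
      let ?x = "real i / real m" and ?y = "real j / real m"
      let ?x' = "real (Suc i) / real m" and ?y' = "real (Suc j) / real m"
      have mesh: "?x' = ?x + 1 / real m" "?y' = ?y + 1 / real m"
        by (simp_all add: add_divide_distrib)
      have "emp n \<omega> ?x ?y \<le> emp n \<omega> x y" "emp n \<omega> x y \<le> emp n \<omega> ?x' ?y'"
        using i j by (auto intro!: emp_stdf_mono)
      moreover have "\<bar>emp n \<omega> ?x ?y - L ?x ?y\<bar> \<le> \<epsilon> / 2" "\<bar>emp n \<omega> ?x' ?y' - L ?x' ?y'\<bar> \<le> \<epsilon> / 2"
        using grid[rule_format, of "(i, j)"] grid[rule_format, of "(Suc i, Suc j)"] i j by auto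
      moreover have "\<bar>L ?x ?y - L x y\<bar> \<le> \<epsilon> / 2" "\<bar>L ?x' ?y' - L x y\<bar> \<le> \<epsilon> / 2"
        using L_lipschitz[of ?x ?y x y] L_lipschitz[of ?x' ?y' x y] i(2,3) j(2,3) m(2)
        unfolding mesh by linarith+
      ultimately show "\<bar>emp n \<omega> x y - L x y\<bar> \<le> \<epsilon>"
        by linarith
    qed
  qed
qed

end

section \<open>Moments\<close>

lemma set_integrable_moment:
  fixes g :: "real \<times> real \<Rightarrow> real ^ 'p" and f :: "real \<Rightarrow> real \<Rightarrow> real"
  assumes g: "set_integrable lebesgue unit_square g"
    and f: "case_prod f \<in> borel_measurable borel"
    and bound: "\<And>x y. x \<in> {0..1} \<Longrightarrow> y \<in> {0..1} \<Longrightarrow> \<bar>f x y\<bar> \<le> B"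
  shows "set_integrable lebesgue unit_square (\<lambda>(x, y). f x y *\<^sub>R g (x, y))"
  unfolding set_integrable_def
proof (rule Bochner_Integration.integrable_bound)
  show "integrable lebesgue (\<lambda>z. B *\<^sub>R (indicator unit_square z *\<^sub>R g z))"
    using g unfolding set_integrable_def by (rule integrable_scaleR_right)
  have "case_prod f \<in> borel_measurable lebesgue"
    using f by (intro measurable_completion) simp
  then have "(\<lambda>z. case_prod f z *\<^sub>R (indicator unit_square z *\<^sub>R g z)) \<in> borel_measurable lebesgue"
    by (rule borel_measurable_scaleR[OF _ borel_measurable_integrable[OF g[unfolded set_integrable_def]]])
  moreover have "(\<lambda>z. case_prod f z *\<^sub>R (indicator unit_square z *\<^sub>R g z))
      = (\<lambda>z. indicator unit_square z *\<^sub>R (case z of (x, y) \<Rightarrow> f x y *\<^sub>R g (x, y)))"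
    by (auto simp: fun_eq_iff)
  ultimately show "(\<lambda>z. indicator unit_square z *\<^sub>R (case z of (x, y) \<Rightarrow> f x y *\<^sub>R g (x, y)))
      \<in> borel_measurable lebesgue"
    by simp
  show "AE z in lebesgue. norm (indicator unit_square z *\<^sub>R (case z of (x, y) \<Rightarrow> f x y *\<^sub>R g (x, y)))
      \<le> norm (B *\<^sub>R (indicator unit_square z *\<^sub>R g z))"
    using bound by (intro AE_I2) (force simp: indicator_def intro!: mult_right_mono)
qed

lemma norm_moment_diff_le:
  fixes g :: "real \<times> real \<Rightarrow> real ^ 'p" and f f' :: "real \<Rightarrow> real \<Rightarrow> real"
  assumes g: "set_integrable lebesgue unit_square g"
    and f: "case_prod f \<in> borel_measurable borel" "case_prod f' \<in> borel_measurable borel"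
    and bound: "\<And>x y. x \<in> {0..1} \<Longrightarrow> y \<in> {0..1} \<Longrightarrow> \<bar>f' x y\<bar> \<le> B"
    and close: "\<And>x y. x \<in> {0..1} \<Longrightarrow> y \<in> {0..1} \<Longrightarrow> \<bar>f x y - f' x y\<bar> \<le> \<delta>"
  shows "norm (moment g f - moment g f') \<le> \<delta> * (LINT z:unit_square|lebesgue. norm (g z))"
proof -
  have "\<bar>f x y\<bar> \<le> B + \<delta>" if "x \<in> {0..1}" "y \<in> {0..1}" for x y
    using bound[OF that] close[OF that] by linarith
  then have int: "set_integrable lebesgue unit_square (\<lambda>(x, y). f x y *\<^sub>R g (x, y))"
    "set_integrable lebesgue unit_square (\<lambda>(x, y). f' x y *\<^sub>R g (x, y))"
    using set_integrable_moment[OF g f(1)] set_integrable_moment[OF g f(2) bound] by blast+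
  have int_norm: "set_integrable lebesgue unit_square (\<lambda>z. \<delta> * norm (g z))"
    using g by (intro set_integrable_mult_right set_integrable_norm)
  have "moment g f - moment g f' = (LINT z:unit_square|lebesgue.
      (case z of (x, y) \<Rightarrow> f x y *\<^sub>R g (x, y)) - (case z of (x, y) \<Rightarrow> f' x y *\<^sub>R g (x, y)))"
    unfolding moment_def by (rule set_integral_diff(2)[OF int, symmetric])
  also have "norm \<dots> \<le> (LINT z:unit_square|lebesgue. \<delta> * norm (g z))"
    unfolding set_lebesgue_integral_def
  proof (rule Bochner_Integration.integral_norm_bound_integral)
    show "integrable lebesgue (\<lambda>z. indicator unit_square z *\<^sub>R (\<delta> * norm (g z)))"
      using int_norm by (simp only: set_integrable_def)
    show "integrable lebesgue (\<lambda>z. indicator unit_square z *\<^sub>R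
      ((case z of (x, y) \<Rightarrow> f x y *\<^sub>R g (x, y)) - (case z of (x, y) \<Rightarrow> f' x y *\<^sub>R g (x, y))))"
      using set_integral_diff(1)[OF int] by (simp only: set_integrable_def)
    show "norm (indicator unit_square z *\<^sub>R
      ((case z of (x, y) \<Rightarrow> f x y *\<^sub>R g (x, y)) - (case z of (x, y) \<Rightarrow> f' x y *\<^sub>R g (x, y))))
      \<le> indicator unit_square z *\<^sub>R (\<delta> * norm (g z))" for z
      using close by (cases z) (auto simp: indicator_def scaleR_left_diff_distrib[symmetric] intro!: mult_right_mono)
  qed
  also have "\<dots> = \<delta> * (LINT z:unit_square|lebesgue. norm (g z))"
    by (rule set_integral_mult_right)
  finally show ?thesis .
qed

lemma borel_measurable_emp_stdf: "case_prod (emp_stdf n k u v) \<in> borel_measurable borel"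
proof -
  note [measurable] = measurable_fst_snd_plane
  show ?thesis
    unfolding emp_stdf_def case_prod_unfold by measurable
qed

context tail_sample
begin

lemma continuous_on_L: "continuous_on UNIV (case_prod L)"
proof -
  have "\<bar>case_prod L z - case_prod L z'\<bar> \<le> 2 * dist z z'" for z z'
  proof -
    have "\<bar>fst z - fst z'\<bar> \<le> dist z z'" "\<bar>snd z - snd z'\<bar> \<le> dist z z'"
      using dist_fst_le[of z z'] dist_snd_le[of z z'] by (simp_all add: dist_real_def)
    then show ?thesis
      using L_lipschitz[of "fst z" "snd z" "fst z'" "snd z'"] by (simp add: case_prod_unfold)
  qed
  then have "2-lipschitz_on UNIV (case_prod L)"
    by (intro lipschitz_onI) (auto simp: dist_real_def)
  then show ?thesis by (rule lipschitz_on_continuous_on)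
qed

lemma moment_L: "moment g L = moment g l"
  unfolding moment_def set_lebesgue_integral_def
  by (intro Bochner_Integration.integral_cong) (auto simp: L_eq indicator_def)

text \<open>Uniform convergence passes to the integral against the integrable weight \<open>g\<close>. The constant
  \<open>C + 1\<close> instead of \<open>C\<close> avoids division by zero when \<open>g\<close> vanishes almost everywhere.\<close>

lemma moment_emp_whp:
  fixes g :: "real \<times> real \<Rightarrow> real ^ 'p"
  assumes g: "set_integrable lebesgue unit_square g" and "\<eta> > 0"
  shows "whp M (\<lambda>n \<omega>. dist (moment g (emp n \<omega>)) (moment g l) \<le> \<eta>)"
proof -
  define C where "C = (LINT z:unit_square|lebesgue. norm (g z))"
  have "C \<ge> 0"
    unfolding C_def set_lebesgue_integral_def by (intro Bochner_Integration.integral_nonneg) auto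
  define \<delta> where "\<delta> = \<eta> / (C + 1)"
  have \<delta>: "\<delta> > 0" "\<delta> * C \<le> \<eta>"
    using \<open>C \<ge> 0\<close> \<open>\<eta> > 0\<close> by (auto simp: \<delta>_def field_simps)
  have L_bound: "\<bar>L x y\<bar> \<le> \<bar>L 0 0\<bar> + 2" if "x \<in> {0..1}" "y \<in> {0..1}" for x y
    using L_lipschitz[of x y 0 0] that unfolding atLeastAtMost_iff by linarith
  have L_meas: "case_prod L \<in> borel_measurable borel"
    by (rule borel_measurable_continuous_onI[OF continuous_on_L])
  from emp_uniform_whp[OF \<delta>(1)] show ?thesis
  proof (rule whp_mono, goal_cases)
    case (1 n)
    show ?case by (rule sets_emp)
  next
    case 2
    show ?case
    proof (intro always_eventually allI ballI impI)
      fix n \<omega>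
      assume "\<forall>x\<in>{0..1}. \<forall>y\<in>{0..1}. \<bar>emp n \<omega> x y - L x y\<bar> \<le> \<delta>"
      then have "norm (moment g (emp n \<omega>) - moment g L) \<le> \<delta> * C"
        unfolding C_def
        by (intro norm_moment_diff_le[OF g borel_measurable_emp_stdf L_meas L_bound]) auto
      then show "dist (moment g (emp n \<omega>)) (moment g l) \<le> \<eta>"
        using \<delta>(2) by (simp add: dist_norm moment_L)
    qed
  qed
qed

end

section \<open>Consistency of the moment estimator\<close>

text \<open>Since \<open>\<phi>\<close> maps between spaces of the same dimension, the image of an open set is open by
  invariance of domain. Values close to \<open>\<phi> a\<close> therefore lie in the image, where the inverse is
  continuous.\<close>

lemma homeomorphism_interior_inverse_continuous:
  fixes \<phi> :: "'b::euclidean_space \<Rightarrow> 'b"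
  assumes hom: "homeomorphism (interior A) (\<phi> ` interior A) \<phi> \<psi>" and a: "a \<in> interior A" and "\<epsilon> > 0"
  shows "\<exists>\<eta>>0. \<forall>m. dist m (\<phi> a) \<le> \<eta> \<longrightarrow> m \<in> \<phi> ` interior A \<and> dist (the_inv_into (interior A) \<phi> m) a \<le> \<epsilon>"
proof -
  have inj: "inj_on \<phi> (interior A)"
    using hom by (metis homeomorphism_apply1 inj_on_inverseI)
  have opn: "open (\<phi> ` interior A)"
    using hom inj by (intro invariance_of_domain) (auto simp: homeomorphism_def)
  have "isCont \<psi> (\<phi> a)"
    using hom a opn by (auto simp: homeomorphism_def continuous_on_eq_continuous_at)
  then obtain d where d: "d > 0" "\<And>m. dist m (\<phi> a) < d \<Longrightarrow> dist (\<psi> m) (\<psi> (\<phi> a)) < \<epsilon>"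
    using \<open>\<epsilon> > 0\<close> by (auto simp: continuous_at_eps_delta)
  obtain e where e: "e > 0" "ball (\<phi> a) e \<subseteq> \<phi> ` interior A"
    using opn a by (meson imageI open_contains_ball)
  have inv: "the_inv_into (interior A) \<phi> m = \<psi> m" if "m \<in> \<phi> ` interior A" for m
    using that hom inj by (auto simp: the_inv_into_f_f homeomorphism_apply1)
  have "m \<in> \<phi> ` interior A \<and> dist (the_inv_into (interior A) \<phi> m) a \<le> \<epsilon>"
    if "dist m (\<phi> a) \<le> min d e / 2" for m
  proof
    show mem: "m \<in> \<phi> ` interior A"
      using that e d(1) by (intro subsetD[OF e(2)]) (auto simp: dist_commute min_def split: if_splits)
    have "dist m (\<phi> a) < d"
      using that e(1) d(1) by (auto simp: min_def split: if_splits)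
    then show "dist (the_inv_into (interior A) \<phi> m) a \<le> \<epsilon>"
      using d(2)[of m] inv[OF mem] homeomorphism_apply1[OF hom a] by simp
  qed
  then show ?thesis
    using d(1) e(1) by (intro exI[of _ "min d e / 2"]) auto
qed

theorem theorem4p1:
  fixes M :: "'a measure"
    and X Y :: "nat \<Rightarrow> 'a \<Rightarrow> real"  \<comment> \<open>index 0: the generic vector; indices 1, 2, ...: the sample\<close>
    and F :: "real \<times> real \<Rightarrow> real"
    and Theta :: "(real ^ 'p) set"
    and l :: "real ^ 'p \<Rightarrow> real \<Rightarrow> real \<Rightarrow> real"
    and g :: "real \<times> real \<Rightarrow> real ^ 'p"
    and \<phi> :: "real ^ 'p \<Rightarrow> real ^ 'p"
    and \<theta>0 \<theta>' :: "real ^ 'p"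
    and k :: "nat \<Rightarrow> nat"
  assumes "prob_space M"
    and "prob_space.indep_vars M (\<lambda>_. borel) (\<lambda>i \<omega>. (X i \<omega>, Y i \<omega>)) UNIV"
    and "\<And>i. joint_cdf M (X i) (Y i) = F"
    and "continuous_on UNIV F"
    and "\<And>\<theta>. \<theta> \<in> Theta \<Longrightarrow> is_stdf (l \<theta>)"
    and "has_stdf M (X 0) (Y 0) (l \<theta>0)"
    and "set_integrable lebesgue unit_square g"
    and "\<And>\<theta>. \<phi> \<theta> = moment g (l \<theta>)"
    and "\<exists>\<psi>. homeomorphism (interior Theta) (\<phi> ` interior Theta) \<phi> \<psi>"
    and "\<theta>0 \<in> interior Theta"
    and "\<theta>' \<in> Theta"
    and "\<And>n. n \<ge> 1 \<Longrightarrow> k n \<in> {1..n}"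
    and "filterlim k at_top sequentially"
    and "(\<lambda>n. real (k n) / real n) \<longlonglongrightarrow> 0"
  shows "(\<lambda>n. measure M {\<omega> \<in> space M.
            moment g (emp_stdf n (k n) (\<lambda>i. X i \<omega>) (\<lambda>i. Y i \<omega>)) \<in> \<phi> ` interior Theta})
          \<longlonglongrightarrow> 1 \<and>
         tendsto_in_probability M
           (\<lambda>n \<omega>. moment_estimator g l Theta \<theta>' n (k n) (\<lambda>i. X i \<omega>) (\<lambda>i. Y i \<omega>)) \<theta>0"
proof -
  interpret tail_sample M X Y F "l \<theta>0" k
    by (intro tail_sample.intro tail_sample_axioms.intro assms)
  obtain \<psi> where hom: "homeomorphism (interior Theta) (\<phi> ` interior Theta) \<phi> \<psi>"
    using assms(9) by blast
  have \<phi>_eq: "(\<lambda>\<theta>. moment g (l \<theta>)) = \<phi>"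
    using assms(8) by auto
  let ?m = "\<lambda>n \<omega>. moment g (emp n \<omega>)"
  let ?est = "\<lambda>n \<omega>. moment_estimator g l Theta \<theta>' n (k n) (\<lambda>i. X i \<omega>) (\<lambda>i. Y i \<omega>)"
  have est: "?est n \<omega> = (if ?m n \<omega> \<in> \<phi> ` interior Theta
      then the_inv_into (interior Theta) \<phi> (?m n \<omega>) else \<theta>')" for n \<omega>
    unfolding moment_estimator_def Let_def \<phi>_eq ..
  have est_meas: "?est n \<in> borel_measurable M" for n
    unfolding est
    using measurable_emp_stdf_functional[of X M Y "\<lambda>f. if moment g f \<in> \<phi> ` interior Theta
      then the_inv_into (interior Theta) \<phi> (moment g f) else \<theta>'" borel n "k n"] by simp
  have good: "whp M (\<lambda>n \<omega>. ?m n \<omega> \<in> \<phi> ` interior Theta \<and> dist (?est n \<omega>) \<theta>0 \<le> \<epsilon>)" if "\<epsilon> > 0" for \<epsilon>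
  proof -
    obtain \<eta> where \<eta>: "\<eta> > 0" "\<And>m. dist m (\<phi> \<theta>0) \<le> \<eta> \<Longrightarrow>
        m \<in> \<phi> ` interior Theta \<and> dist (the_inv_into (interior Theta) \<phi> m) \<theta>0 \<le> \<epsilon>"
      using homeomorphism_interior_inverse_continuous[OF hom assms(10) \<open>\<epsilon> > 0\<close>] by blast
    have "whp M (\<lambda>n \<omega>. dist (?m n \<omega>) (\<phi> \<theta>0) \<le> \<eta>)"
      using moment_emp_whp[OF assms(7) \<eta>(1)] by (simp add: assms(8))
    then show ?thesis
    proof (rule whp_mono)
      show "{\<omega> \<in> space M. ?m n \<omega> \<in> \<phi> ` interior Theta \<and> dist (?est n \<omega>) \<theta>0 \<le> \<epsilon>} \<in> events" for n
        unfolding est by (rule sets_emp)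
      show "\<forall>\<^sub>F n in sequentially. \<forall>\<omega>\<in>space M. dist (?m n \<omega>) (\<phi> \<theta>0) \<le> \<eta> \<longrightarrow>
          ?m n \<omega> \<in> \<phi> ` interior Theta \<and> dist (?est n \<omega>) \<theta>0 \<le> \<epsilon>"
        using \<eta>(2) by (intro always_eventually allI ballI impI) (simp add: est)
    qed
  qed
  have "whp M (\<lambda>n \<omega>. ?m n \<omega> \<in> \<phi> ` interior Theta)"
    by (rule whp_mono[OF good[of 1]]) (auto intro: sets_emp)
  moreover have "whp M (\<lambda>n \<omega>. dist (?est n \<omega>) \<theta>0 \<le> \<epsilon>)" if "\<epsilon> > 0" for \<epsilon>
  proof (rule whp_mono[OF good[OF \<open>\<epsilon> > 0\<close>]])
    show "{\<omega> \<in> space M. dist (?est n \<omega>) \<theta>0 \<le> \<epsilon>} \<in> events" for n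
      unfolding est by (rule sets_emp)
  qed simp
  ultimately show ?thesis
    using whp_imp_prob_tendsto_1 est_meas by (simp add: tendsto_in_probability_iff_whp)
qed

end
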